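(* Assume stochastic linearity, the deviation condition and convexity as formulated in the context. Fix $\mathtt{x}>0$, and let $B=\mathbb{F}^{-1/2}V^2\mathbb{F}^{-1/2}$, $r_B=z(B,\mathtt{x})$. Let the smoothness condition $(\mathcal{T}_3)$ (see context) hold at $\upsilon^*$ with a symmetric positive definite metric tensor $D$ and values $\mathtt{r}$ and $\tau_3$ satisfying, for some $\varkappa>0$, $$D^2\le\varkappa^2\,\mathbb{F},\qquad \mathtt{r}\ge\frac{4\varkappa}{3}r_B,\qquad \tau_3\,\varkappa^3\,r_B<\frac14 .$$ Then on the random set $\Omega(\mathtt{x})=\{\|\mathbb{F}^{-1/2}\nabla\zeta\|\le r_B\}$, which has probability at least $1-3e^{-\mathtt{x}}$, it holds $$\|\mathbb{F}^{1/2}(\tilde\upsilon-\upsilon^* )\|\le\frac43r_B,\qquad\|D(\tilde\upsilon-\upsilon^* )\|\le\frac{4\varkappa}{3}r_B,$$ and $$\Bigl|2L(\tilde\upsilon)-2L(\upsilon^* )+\|\mathbb{F}^{-1/2}\nabla\zeta\|^2\Bigr|\le\frac{\tau_3}{2}\,\|D\,\mathbb{F}^{-1}\nabla\zeta\|^3 .$$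
   Context: Let $L(\upsilon)$, $\upsilon\in\Upsilon\subseteq\mathbb{R}^p$ ($p<\infty$), be a real random function (e.g. a negative log-likelihood). Set $f(\upsilon)=\mathbb{E}L(\upsilon)$, $\tilde\upsilon=\arg\min_{\upsilon}L(\upsilon)$, $\upsilon^*=\arg\min_\upsilon \mathbb{E}L(\upsilon)$, $\mathbb{F}=\nabla^2 f(\upsilon^* )$, assumed positive definite. Norms are Euclidean for vectors and operator norms for matrices; inequalities between symmetric matrices are in the positive semidefinite order. Points $\upsilon^*+u$ at which derivatives are evaluated are understood to lie in $\Upsilon$. Stochastic linearity: $\zeta(\upsilon)=L(\upsilon)-\mathbb{E}L(\upsilon)$ is linear in $\upsilon$; its gradient, not depending on $\upsilon$, is the random vector $\nabla\zeta\in\mathbb{R}^p$. Deviation condition: there is a symmetric positive definite matrix $V^2\ge\mathrm{Var}(\nabla\zeta)$ such that for all symmetric positive definite $B\in\mathbb{R}^{p\times p}$ and $\mathtt{x}>0$ $$\mathbb{P}(\|B^{1/2}V^{-1}\nabla\zeta\|\ge z(B,\mathtt{x}))\le3e^{-\mathtt{x}},\qquad z^2(B,\mathtt{x})=\mathrm{tr}B+2\sqrt{\mathtt{x}\,\mathrm{tr}B^2}+2\mathtt{x}\|B\|.$$ Convexity: $\Upsilon$ is open and convex and $f=\mathbb{E}L$ is convex on $\Upsilon$. Condition $(\mathcal{T}_3)$ at $\upsilon^*$ with $D,\mathtt{r},\tau_3$: for all $u\in\mathbb{R}^p$ with $\|Du\|\le\mathtt{r}$, $$\Bigl|f(\upsilon^*+u)-f(\upsilon^*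 )-\langle\nabla f(\upsilon^* ),u\rangle-\tfrac12\langle\nabla^2f(\upsilon^* ),u^{\otimes2}\rangle\Bigr|\le\frac{\tau_3}{6}\|Du\|^3,$$ $$\Bigl|\langle\nabla f(\upsilon^*+u),u\rangle-\langle\nabla f(\upsilon^* ),u\rangle-\langle\nabla^2f(\upsilon^* ),u^{\otimes2}\rangle\Bigr|\le\frac{\tau_3}{2}\|Du\|^3 .$$ *)

theory Defs
  imports "HOL-Probability.Probability"
begin

definition positive_semidefinite :: "real^'n^'n \<Rightarrow> bool" where
  "positive_semidefinite A \<longleftrightarrow> transpose A = A \<and> (\<forall>x. 0 \<le> x \<bullet> (A *v x))"

definition positive_definite :: "real^'n^'n \<Rightarrow> bool" where
  "positive_definite A \<longleftrightarrow> transpose A = A \<and> (\<forall>x. x \<noteq> 0 \<longrightarrow> 0 < x \<bullet> (A *v x))"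

definition loewner_le :: "real^'n^'n \<Rightarrow> real^'n^'n \<Rightarrow> bool" (infix \<open>\<preceq>\<^sub>L\<close> 50) where
  "A \<preceq>\<^sub>L B \<longleftrightarrow> positive_semidefinite (B - A)"

text \<open>
  The power \<open>1/2\<close> of a positive semidefinite matrix, i.e. its unique positive semidefinite
  square root.
\<close>

definition matrix_sqrt :: "real^'n^'n \<Rightarrow> real^'n^'n" where
  "matrix_sqrt A = (THE S. positive_semidefinite S \<and> S ** S = A)"

definition op_norm :: "real^'n^'m \<Rightarrow> real" where
  "op_norm A = onorm (\<lambda>x. A *v x)"

definition grad :: "(real^'n \<Rightarrow> real) \<Rightarrow> real^'n \<Rightarrow> real^'n" where
  "grad f x = (THE g. GDERIV f x :> g)"

definition hessian :: "(real^'n \<Rightarrow> real) \<Rightarrow> real^'n \<Rightarrow> real^'n^'n" where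
  "hessian f x = jacobian (grad f) (at x)"

text \<open>
  The value \<^term>\<open>hessian f x\<close> is meaningful exactly under the following condition.
\<close>

definition twice_differentiable_at :: "(real^'n \<Rightarrow> real) \<Rightarrow> real^'n \<Rightarrow> bool" where
  "twice_differentiable_at f x \<longleftrightarrow>
     (\<forall>\<^sub>F y in nhds x. f differentiable (at y)) \<and> grad f differentiable (at x)"

definition covariance_matrix :: "'a measure \<Rightarrow> ('a \<Rightarrow> real^'n) \<Rightarrow> real^'n^'n" where
  "covariance_matrix M X =
     (\<chi> i j. \<integral>\<omega>. (X \<omega> $ i - (\<integral>\<omega>'. X \<omega>' $ i \<partial>M)) * (X \<omega> $ j - (\<integral>\<omega>'. X \<omega>' $ j \<partial>M)) \<partial>M)"

definition quantile_bound :: "real^'n^'n \<Rightarrow> real \<Rightarrow> real" where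
  "quantile_bound B x =
     sqrt (trace B + 2 * sqrt (x * trace (B ** B)) + 2 * x * op_norm B)"

text \<open>
  Linearity of \<open>\<zeta>(\<upsilon>) = L(\<upsilon>) - E L(\<upsilon>)\<close> in \<open>\<upsilon>\<close> allows for a random offset that does not depend
  on \<open>\<upsilon>\<close>.  Where \<open>\<Upsilon>\<close> is open and nonempty, \<^term>\<open>g\<close> is thereby determined as the
  (constant) gradient of \<open>\<zeta>\<close> on \<open>\<Upsilon>\<close>.
\<close>

definition stochastically_linear ::
    "'a measure \<Rightarrow> ('a \<Rightarrow> real^'n \<Rightarrow> real) \<Rightarrow> (real^'n) set \<Rightarrow> ('a \<Rightarrow> real^'n) \<Rightarrow> bool" where
  "stochastically_linear M L \<Upsilon> g \<longleftrightarrow>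
     g \<in> borel_measurable M \<and>
     (\<forall>\<omega>\<in>space M. \<exists>c. \<forall>\<upsilon>\<in>\<Upsilon>. L \<omega> \<upsilon> - (\<integral>\<omega>'. L \<omega>' \<upsilon> \<partial>M) = c + g \<omega> \<bullet> \<upsilon>)"

text \<open>
  The matrix written \<open>V\<^sup>2\<close> in the mathematics is the argument \<open>V2\<close>; its square root is
  \<open>V\<close>.  Square integrability is what makes the covariance matrix meaningful.
\<close>

definition deviation_condition ::
    "'a measure \<Rightarrow> ('a \<Rightarrow> real^'n) \<Rightarrow> real^'n^'n \<Rightarrow> bool" where
  "deviation_condition M g V2 \<longleftrightarrow>
     positive_definite V2 \<and>
     (\<forall>i. integrable M (\<lambda>\<omega>. (g \<omega> $ i)\<^sup>2)) \<and>
     covariance_matrix M g \<preceq>\<^sub>L V2 \<and>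
     (\<forall>B x. positive_definite B \<longrightarrow> 0 < x \<longrightarrow>
        measure M {\<omega> \<in> space M.
            quantile_bound B x \<le> norm (matrix_sqrt B *v (matrix_inv (matrix_sqrt V2) *v g \<omega>))}
          \<le> 3 * exp (- x))"

text \<open>
  Only the values of \<^term>\<open>f\<close> on \<open>\<Upsilon>\<close> are meaningful, hence all points at which \<^term>\<open>f\<close> or
  its gradient is evaluated are required to lie in \<open>\<Upsilon>\<close>, and \<^term>\<open>f\<close> is required to be
  differentiable there.
\<close>

definition condition_T3 ::
    "(real^'n \<Rightarrow> real) \<Rightarrow> (real^'n) set \<Rightarrow> real^'n \<Rightarrow> real^'n^'n \<Rightarrow> real \<Rightarrow> real \<Rightarrow> bool" where
  "condition_T3 f \<Upsilon> \<upsilon> D r \<tau>\<^sub>3 \<longleftrightarrow>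
     twice_differentiable_at f \<upsilon> \<and>
     (\<forall>u. norm (D *v u) \<le> r \<longrightarrow>
        \<upsilon> + u \<in> \<Upsilon> \<and> f differentiable (at (\<upsilon> + u)) \<and>
        \<bar>f (\<upsilon> + u) - f \<upsilon> - grad f \<upsilon> \<bullet> u - 1 / 2 * (u \<bullet> (hessian f \<upsilon> *v u))\<bar>
          \<le> \<tau>\<^sub>3 / 6 * norm (D *v u) ^ 3 \<and>
        \<bar>grad f (\<upsilon> + u) \<bullet> u - grad f \<upsilon> \<bullet> u - u \<bullet> (hessian f \<upsilon> *v u)\<bar>
          \<le> \<tau>\<^sub>3 / 2 * norm (D *v u) ^ 3)"

end

theory Submission
  imports Defs
begin

text \<open>
  On the random set, \<open>L\<close> is up to a constant the function \<open>h(\<upsilon>\<^sup>* + u) = f(\<upsilon>\<^sup>* + u) + \<langle>\<nabla>\<zeta>, u\<rangle>\<close>. By the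
  gradient part of \<open>(T\<^sub>3)\<close> its radial derivative is positive on the ellipsoid
  \<open>\<parallel>F\<^sup>1\<^sup>/\<^sup>2 u\<parallel> = 4/3 r\<^sub>B\<close>, so by convexity every minimizer lies inside. There
  \<open>2 h(\<upsilon>\<^sup>* + u) - 2 h(\<upsilon>\<^sup>*) + \<parallel>F\<^sup>-\<^sup>1\<^sup>/\<^sup>2 \<nabla>\<zeta>\<parallel>\<^sup>2\<close> equals \<open>\<parallel>F\<^sup>1\<^sup>/\<^sup>2 u + F\<^sup>-\<^sup>1\<^sup>/\<^sup>2 \<nabla>\<zeta>\<parallel>\<^sup>2\<close> up to
  \<open>\<tau>\<^sub>3/3 \<parallel>D u\<parallel>\<^sup>3\<close>. Comparing with \<open>u = - F\<^sup>-\<^sup>1 \<nabla>\<zeta>\<close> bounds the minimum from above; from below,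
  the square absorbs the excess of \<open>\<tau>\<^sub>3/3 \<parallel>D u\<parallel>\<^sup>3\<close> over \<open>\<tau>\<^sub>3/2 \<parallel>D F\<^sup>-\<^sup>1 \<nabla>\<zeta>\<parallel>\<^sup>3\<close>.
\<close>

subsection \<open>Square roots of positive semidefinite matrices\<close>

lemma symmetric_inner_swap:
  fixes A :: "real^'n^'n"
  assumes "transpose A = A"
  shows "x \<bullet> (A *v y) = (A *v x) \<bullet> y"
  by (metis assms dot_lmul_matrix transpose_matrix_vector)

lemma transpose_eqI:
  fixes A :: "real^'n^'n"
  assumes "\<And>x y. x \<bullet> (A *v y) = (A *v x) \<bullet> y"
  shows "transpose A = A"
proof -
  have "transpose A *v x = A *v x" for x
  proof -
    have "(transpose A *v x) \<bullet> y = (A *v x) \<bullet> y" for y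
      by (metis assms dot_lmul_matrix transpose_matrix_vector)
    then show ?thesis by (metis vector_eq_rdot)
  qed
  then show ?thesis by (simp add: matrix_eq)
qed

text \<open>A zero of a nonnegative form is a minimum, so the linear term along
  \<open>v + t *\<^sub>R w\<close> must vanish. The subspace \<open>W\<close> allows use on an
  invariant complement.\<close>

lemma nonneg_form_zero:
  fixes h :: "'a::real_inner \<Rightarrow> 'a"
  assumes lin: "linear h" and W: "subspace W"
    and sym: "\<And>x y. x \<in> W \<Longrightarrow> y \<in> W \<Longrightarrow> x \<bullet> h y = h x \<bullet> y"
    and nonneg: "\<And>x. x \<in> W \<Longrightarrow> 0 \<le> x \<bullet> h x"
    and v: "v \<in> W" "v \<bullet> h v = 0" and w: "w \<in> W"
  shows "h v \<bullet> w = 0"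
proof (rule ccontr)
  assume ne: "h v \<bullet> w \<noteq> 0"
  define b where "b = h v \<bullet> w"
  define c where "c = w \<bullet> h w"
  have c: "c \<ge> 0" unfolding c_def using nonneg w by blast
  have q: "0 \<le> 2 * t * b + t\<^sup>2 * c" for t
  proof -
    have "0 \<le> (v + t *\<^sub>R w) \<bullet> h (v + t *\<^sub>R w)"
      by (intro nonneg subspace_add W v subspace_scale w)
    also have "\<dots> = 2 * t * b + t\<^sup>2 * c"
      using sym[OF v(1) w] v(2) unfolding b_def c_def
      by (simp add: linear_add[OF lin] linear_cmul[OF lin] inner_add_left inner_add_right
          power2_eq_square algebra_simps inner_commute)
    finally show ?thesis .
  qed
  \<comment> \<open>At \<open>- t\<close> the form takes the value -t^2 (c + 2); the shift by 1
    keeps the denominator positive when \<open>c = 0\<close>.\<close>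
  define t where "t = b / (c + 1)"
  have b: "b = t * (c + 1)" using c by (simp add: t_def)
  have "0 \<le> 2 * (- t) * b + (- t)\<^sup>2 * c" by (rule q)
  also have "\<dots> = - (t\<^sup>2 * (c + 2))"
    unfolding b by (simp add: power2_eq_square algebra_simps)
  also have "\<dots> < 0"
    using c ne b unfolding b_def[symmetric] by simp
  finally show False by simp
qed

text \<open>The Rayleigh quotient attains its maximum \<open>l\<close> on the compact unit sphere of
  \<open>W\<close>; the form of l - h is then nonnegative on \<open>W\<close> and zero at
  \<open>v\<close>. The maximality clause is kept for the uniqueness of square roots.\<close>

lemma symmetric_exists_eigenvector:
  fixes h :: "'a::euclidean_space \<Rightarrow> 'a"
  assumes lin: "linear h" and W: "subspace W" and inv: "\<And>x. x \<in> W \<Longrightarrow> h x \<in> W"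
    and sym: "\<And>x y. x \<bullet> h y = h x \<bullet> y" and nz: "w \<in> W" "w \<noteq> 0"
  obtains v l where "v \<in> W" "norm v = 1" "h v = l *\<^sub>R v"
    "\<And>x. x \<in> W \<Longrightarrow> x \<bullet> h x \<le> l * (x \<bullet> x)"
proof -
  have "compact (sphere 0 1 \<inter> W)"
    by (intro compact_Int_closed closed_subspace W) auto
  moreover have "(1 / norm w) *\<^sub>R w \<in> sphere 0 1 \<inter> W"
    using nz W by (auto intro: subspace_scale)
  moreover have "continuous_on (sphere 0 1 \<inter> W) (\<lambda>x. x \<bullet> h x)"
    by (intro continuous_intros linear_continuous_on lin[unfolded linear_conv_bounded_linear])
  ultimately obtain v where v: "v \<in> sphere 0 1 \<inter> W"
    and max: "\<And>x. x \<in> sphere 0 1 \<inter> W \<Longrightarrow> x \<bullet> h x \<le> v \<bullet> h v"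
    using continuous_attains_sup[of "sphere 0 1 \<inter> W" "\<lambda>x. x \<bullet> h x"] by blast
  define l where "l = v \<bullet> h v"
  have v1: "norm v = 1" "v \<in> W" using v by auto
  have bound: "x \<bullet> h x \<le> l * (x \<bullet> x)" if "x \<in> W" for x
  proof (cases "x = 0")
    case False
    have "((1 / norm x) *\<^sub>R x) \<bullet> h ((1 / norm x) *\<^sub>R x) \<le> l"
      unfolding l_def using False that W by (intro max) (auto intro: subspace_scale)
    then show ?thesis
      using False by (simp add: linear_cmul[OF lin] dot_square_norm field_simps power2_eq_square)
  qed (simp add: linear_0[OF lin])
  define k where "k = (\<lambda>x. l *\<^sub>R x - h x)"
  have "linear k" unfolding k_def
    by (intro linear_compose_sub lin linear_compose_scale_right linear_ident)
  moreover have "x \<bullet> k y = k x \<bullet> y" for x y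
    using sym by (simp add: k_def inner_diff_left inner_diff_right)
  moreover have "0 \<le> x \<bullet> k x" if "x \<in> W" for x
    using bound[OF that] by (simp add: k_def inner_diff_right)
  moreover have "v \<bullet> k v = 0"
    using v1 by (simp add: k_def inner_diff_right l_def dot_square_norm)
  \<comment> \<open>Invariance of \<open>W\<close> admits \<open>k v\<close> itself as the test
    vector, which forces its norm to vanish.\<close>
  moreover have "k v \<in> W"
    unfolding k_def by (intro subspace_diff W subspace_scale inv v1)
  ultimately have "k v \<bullet> k v = 0"
    using nonneg_form_zero[of k W v "k v"] W v1 by blast
  then have "h v = l *\<^sub>R v" by (simp add: k_def)
  then show ?thesis using that v1 bound by blast
qed

text \<open>Take an orthonormal set of eigenvectors of maximal cardinality. If it failed to span,
  its orthogonal complement, invariant by symmetry, would supply one more.\<close>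

lemma symmetric_orthonormal_eigenbasis:
  fixes h :: "'a::euclidean_space \<Rightarrow> 'a"
  assumes lin: "linear h" and sym: "\<And>x y. x \<bullet> h y = h x \<bullet> y"
  obtains E where "finite E" "pairwise orthogonal E" "\<And>e. e \<in> E \<Longrightarrow> norm e = 1"
    "\<And>e. e \<in> E \<Longrightarrow> h e = (e \<bullet> h e) *\<^sub>R e" "span E = UNIV"
proof -
  define P where "P E \<longleftrightarrow> pairwise orthogonal E \<and> (\<forall>e\<in>E. norm e = 1 \<and> h e = (e \<bullet> h e) *\<^sub>R e)"
    for E
  have fin: "finite E \<and> card E \<le> DIM('a)" if "P E" for E
  proof -
    have "independent E"
      using that unfolding P_def by (intro pairwise_orthogonal_independent) auto
    then show ?thesis using independent_bound by auto
  qed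
  have "P {}" by (simp add: P_def)
  moreover have "\<forall>E. P E \<longrightarrow> card E < Suc DIM('a)" using fin by (simp add: less_Suc_eq_le)
  ultimately obtain E where E: "P E" and max: "\<And>E'. P E' \<Longrightarrow> card E' \<le> card E"
    using ex_has_greatest_nat[of P "{}" card "Suc DIM('a)"] by auto
  have fE: "finite E" using fin E by blast
  have "x \<in> span E" for x
  proof (rule ccontr)
    assume "x \<notin> span E"
    then have "span E \<subset> span UNIV" by auto
    then obtain w where w: "w \<noteq> 0" "\<And>y. y \<in> span E \<Longrightarrow> orthogonal w y"
      by (meson orthogonal_to_subspace_exists_gen)
    define W where "W = {y. \<forall>e\<in>E. e \<bullet> y = 0}"
    have W: "subspace W" unfolding W_def subspace_def by (auto simp: inner_add_right)
    have "w \<in> W"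
      unfolding W_def using w(2)[OF span_base] by (auto simp: orthogonal_def inner_commute)
    moreover have "h y \<in> W" if "y \<in> W" for y
    proof -
      have "e \<bullet> h y = 0" if "e \<in> E" for e
      proof -
        have "h e = (e \<bullet> h e) *\<^sub>R e" "e \<bullet> y = 0"
          using E \<open>e \<in> E\<close> \<open>y \<in> W\<close> unfolding P_def W_def by auto
        then show ?thesis by (metis sym inner_scaleR_left mult_zero_right)
      qed
      then show ?thesis by (simp add: W_def)
    qed
    ultimately obtain v l where v: "v \<in> W" "norm v = 1" "h v = l *\<^sub>R v"
      using symmetric_exists_eigenvector[OF lin W _ sym _ w(1)] by metis
    have "P (insert v E)"
      using E v unfolding P_def W_def
      by (auto simp: pairwise_insert orthogonal_def inner_commute dot_square_norm)
    moreover have "v \<notin> E" using v by (auto simp: W_def)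
    ultimately show False using max[of "insert v E"] fE by simp
  qed
  then show ?thesis using that[of E] E fE unfolding P_def by blast
qed

section \<open>Existence and uniqueness of positive semidefinite square roots\<close>

lemma positive_semidefiniteI:
  fixes A :: "real^'n^'n"
  assumes "\<And>x y. x \<bullet> (A *v y) = (A *v x) \<bullet> y" "\<And>x. 0 \<le> x \<bullet> (A *v x)"
  shows "positive_semidefinite A"
  using assms transpose_eqI unfolding positive_semidefinite_def by blast

lemma positive_definite_imp_semidefinite:
  "positive_definite A \<Longrightarrow> positive_semidefinite A"
  unfolding positive_definite_def positive_semidefinite_def
  by (metis inner_zero_left less_eq_real_def)

lemma positive_semidefinite_zeroD:
  fixes A :: "real^'n^'n"
  assumes "positive_semidefinite A" "v \<bullet> (A *v v) = 0"
  shows "A *v v = 0"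
proof -
  have "(A *v v) \<bullet> (A *v v) = 0"
    by (rule nonneg_form_zero[where W = UNIV])
      (use assms symmetric_inner_swap in \<open>auto simp: positive_semidefinite_def matrix_vector_mul_linear\<close>)
  then show ?thesis by simp
qed

text \<open>Keep an orthonormal eigenbasis and replace each eigenvalue by its square root.\<close>

lemma ex_positive_semidefinite_sqrt:
  fixes A :: "real^'n^'n"
  assumes "positive_semidefinite A"
  obtains S where "positive_semidefinite S" "S ** S = A"
proof -
  have sym: "x \<bullet> (A *v y) = (A *v x) \<bullet> y" for x y
    using assms symmetric_inner_swap unfolding positive_semidefinite_def by blast
  obtain E where E: "finite E" "pairwise orthogonal E" "\<And>e. e \<in> E \<Longrightarrow> norm e = 1"
    "\<And>e. e \<in> E \<Longrightarrow> A *v e = (e \<bullet> (A *v e)) *\<^sub>R e" "span E = UNIV"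
    using symmetric_orthonormal_eigenbasis[OF matrix_vector_mul_linear sym] by metis
  define l where "l e = sqrt (e \<bullet> (A *v e))" for e
  have l: "l e \<ge> 0" "l e * l e = e \<bullet> (A *v e)" for e
    using assms unfolding l_def positive_semidefinite_def by auto
  define s where "s x = (\<Sum>e\<in>E. (l e * (e \<bullet> x)) *\<^sub>R e)" for x
  have "linear s"
    unfolding s_def
    by (rule linearI)
      (simp_all add: inner_add_right algebra_simps sum.distrib scaleR_sum_right)
  then have S: "matrix s *v x = s x" for x by (simp add: matrix_works)
  have ssym: "x \<bullet> s y = s x \<bullet> y" for x y
    unfolding s_def inner_sum_left inner_sum_right
    by (intro sum.cong refl) (simp add: inner_commute)
  have "positive_semidefinite (matrix s)"
  proof (rule positive_semidefiniteI)
    show "0 \<le> x \<bullet> (matrix s *v x)" for x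
      unfolding S unfolding s_def inner_sum_right
      by (intro sum_nonneg) (simp add: inner_commute l mult.assoc)
  qed (simp add: S ssym)
  moreover have "matrix s ** matrix s = A"
  proof -
    have inner_s: "e \<bullet> s x = l e * (e \<bullet> x)" if "e \<in> E" for e x
    proof -
      have "e \<bullet> s x = (\<Sum>d\<in>E. if d = e then l e * (e \<bullet> x) else 0)"
        unfolding s_def inner_sum_right
      proof (intro sum.cong refl)
        fix d assume "d \<in> E"
        then show "e \<bullet> (l d * (d \<bullet> x)) *\<^sub>R d = (if d = e then l e * (e \<bullet> x) else 0)"
          using E(2) E(3)[OF that] that
          by (auto simp: dot_square_norm pairwise_def orthogonal_def)
      qed
      then show ?thesis using that E(1) by simp
    qed
    have "s (s x) = A *v x" for x
    proof -
      have "s (s x) = (\<Sum>e\<in>E. ((e \<bullet> (A *v e)) * (e \<bullet> x)) *\<^sub>R e)"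
        unfolding s_def[of "s x"]
        by (intro sum.cong refl) (simp add: inner_s l(2)[symmetric])
      also have "\<dots> = (\<Sum>e\<in>E. (x \<bullet> e) *\<^sub>R (A *v e))"
        \<comment> \<open>Only the right-hand \<open>A *v e\<close> is expanded; the one inside the
          eigenvalue must stay.\<close>
        by (intro sum.cong refl, subst (2) E(4)) (simp_all add: inner_commute mult.commute)
      also have "\<dots> = A *v (\<Sum>e\<in>E. (x \<bullet> e) *\<^sub>R e)"
        by (simp add: linear_sum[OF matrix_vector_mul_linear]
            linear_cmul[OF matrix_vector_mul_linear])
      also have "(\<Sum>e\<in>E. (x \<bullet> e) *\<^sub>R e) = x"
        using orthonormal_basis_expand[of E x] E by (auto simp: inner_commute)
      finally show ?thesis .
    qed
    then show ?thesis
      by (simp add: matrix_eq S flip: matrix_vector_mul_assoc)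
  qed
  ultimately show ?thesis using that by blast
qed

text \<open>If \<open>S\<^sup>2 = T\<^sup>2\<close> and \<open>\<Delta> = S - T\<close>, then \<open>S \<Delta> + \<Delta> T = 0\<close>; testing this on an eigenvector
  \<open>v\<close> of \<open>\<Delta>\<close> with a nonzero eigenvalue makes both forms vanish at \<open>v\<close>, hence \<open>\<Delta> v = 0\<close>. So the
  largest eigenvalue of \<open>\<Delta>\<close> is not positive, and the roles of \<open>S\<close> and \<open>T\<close> may be exchanged.\<close>

lemma positive_semidefinite_sqrt_unique:
  fixes S T :: "real^'n^'n"
  assumes S: "positive_semidefinite S" and T: "positive_semidefinite T" and eq: "S ** S = T ** T"
  shows "S = T"
proof -
  have le: "x \<bullet> ((P - Q) *v x) \<le> 0"
    if P: "positive_semidefinite P" and Q: "positive_semidefinite Q" and eq: "P ** P = Q ** Q"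
    for P Q :: "real^'n^'n" and x
  proof -
    have sym: "x \<bullet> (P *v y) = (P *v x) \<bullet> y" "x \<bullet> (Q *v y) = (Q *v x) \<bullet> y" for x y
      using P Q symmetric_inner_swap unfolding positive_semidefinite_def by blast+
    have symD: "x \<bullet> ((P - Q) *v y) = ((P - Q) *v x) \<bullet> y" for x y
      using sym by (simp add: matrix_vector_mult_diff_rdistrib inner_diff_left inner_diff_right)
    obtain v l where v: "norm v = 1" "(P - Q) *v v = l *\<^sub>R v"
      "\<And>x. x \<bullet> ((P - Q) *v x) \<le> l * (x \<bullet> x)"
      using symmetric_exists_eigenvector[OF matrix_vector_mul_linear subspace_UNIV _ symD,
          where w = "axis undefined 1"] by (auto simp: axis_eq_0_iff)
    have PQ: "P *v v = Q *v v + l *\<^sub>R v"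
      using v(2) by (simp add: matrix_vector_mult_diff_rdistrib algebra_simps)
    have "(P *v v) \<bullet> (P *v v) = (Q *v v) \<bullet> (Q *v v)"
      by (metis eq matrix_vector_mul_assoc sym)
    moreover have "(P *v v) \<bullet> (P *v v) - (Q *v v) \<bullet> (Q *v v)
        = l * (v \<bullet> (P *v v) + v \<bullet> (Q *v v))"
      using v(1) by (simp add: PQ inner_add_left inner_add_right inner_commute algebra_simps)
    ultimately have "l = 0 \<or> v \<bullet> (P *v v) + v \<bullet> (Q *v v) = 0" by simp
    moreover have "v \<bullet> (P *v v) \<ge> 0" "v \<bullet> (Q *v v) \<ge> 0"
      using P Q unfolding positive_semidefinite_def by auto
    ultimately have "l = 0 \<or> (P *v v = 0 \<and> Q *v v = 0)"
      using P Q positive_semidefinite_zeroD by (metis add_nonneg_eq_0_iff)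
    then have "l = 0" using PQ v(1) by auto
    then show ?thesis using v(3)[of x] by simp
  qed
  \<comment> \<open>A symmetric matrix whose form vanishes identically is positive semidefinite, so
    it annihilates every vector.\<close>
  have "x \<bullet> ((T - S) *v x) = 0" for x
    using le[OF S T eq, of x] le[OF T S eq[symmetric], of x]
    by (simp add: matrix_vector_mult_diff_rdistrib inner_diff_right)
  moreover have "transpose (T - S) = T - S"
    using S T by (simp add: positive_semidefinite_def transpose_def vec_eq_iff)
  ultimately have "(T - S) *v x = 0" for x
    by (intro positive_semidefinite_zeroD) (auto simp: positive_semidefinite_def)
  then show ?thesis
    by (simp add: matrix_eq matrix_vector_mult_diff_rdistrib)
qed

lemma matrix_sqrt:
  assumes "positive_semidefinite A"
  shows "positive_semidefinite (matrix_sqrt A)" "matrix_sqrt A ** matrix_sqrt A = A"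
proof -
  have "\<exists>!S. positive_semidefinite S \<and> S ** S = A"
    using ex_positive_semidefinite_sqrt[OF assms] positive_semidefinite_sqrt_unique by metis
  from theI'[OF this] show "positive_semidefinite (matrix_sqrt A)"
    "matrix_sqrt A ** matrix_sqrt A = A" unfolding matrix_sqrt_def by auto
qed

section \<open>Inverses of positive definite matrices and of their square roots\<close>

lemma positive_definite_invertible:
  fixes A :: "real^'n^'n"
  assumes "positive_definite A"
  shows "invertible A"
proof -
  have "x = 0" if "A *v x = 0" for x
    using assms that unfolding positive_definite_def by (metis inner_zero_right less_irrefl)
  then show ?thesis by (simp add: invertible_left_inverse matrix_left_invertible_ker)
qed

lemma matrix_inv:
  assumes "invertible A"
  shows matrix_inv_left: "matrix_inv A ** A = mat 1" and matrix_inv_right: "A ** matrix_inv A = mat 1"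
  using assms unfolding matrix_inv_def invertible_def by (metis (mono_tags, lifting) someI_ex)+

lemma matrix_inv_unique:
  fixes A :: "'a::semiring_1^'n^'m"
  assumes "A ** B = mat 1" "B ** A = mat 1"
  shows "matrix_inv A = B"
  using assms matrix_inv[of A] by (metis invertible_def matrix_mul_assoc matrix_mul_lid matrix_mul_rid)

lemma transpose_matrix_inv:
  fixes A :: "real^'n^'n"
  assumes "invertible A"
  shows "transpose (matrix_inv A) = matrix_inv (transpose A)"
  using matrix_inv[OF assms]
  by (intro matrix_inv_unique[symmetric]) (metis matrix_transpose_mul transpose_mat)+

lemma matrix_sqrt_positive_definite:
  assumes "positive_definite A"
  shows "transpose (matrix_sqrt A) = matrix_sqrt A" "matrix_sqrt A ** matrix_sqrt A = A"
    "invertible (matrix_sqrt A)"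
    "transpose (matrix_inv (matrix_sqrt A)) = matrix_inv (matrix_sqrt A)"
    "matrix_inv A = matrix_inv (matrix_sqrt A) ** matrix_inv (matrix_sqrt A)"
proof -
  note S = matrix_sqrt[OF positive_definite_imp_semidefinite[OF assms]]
  show sym: "transpose (matrix_sqrt A) = matrix_sqrt A"
    using S by (simp add: positive_semidefinite_def)
  show sq: "matrix_sqrt A ** matrix_sqrt A = A" by (rule S)
  have "invertible A" using positive_definite_invertible[OF assms] .
  then show inv: "invertible (matrix_sqrt A)"
    by (metis S(2) invertible_left_inverse invertible_def matrix_mul_assoc)
  show "transpose (matrix_inv (matrix_sqrt A)) = matrix_inv (matrix_sqrt A)"
    using transpose_matrix_inv[OF inv] sym by simp
  show "matrix_inv A = matrix_inv (matrix_sqrt A) ** matrix_inv (matrix_sqrt A)"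
    by (intro matrix_inv_unique) (metis sq matrix_inv[OF inv] matrix_mul_assoc matrix_mul_lid)+
qed

subsection \<open>The deviation bound\<close>

lemma op_norm_bound: "norm (A *v x) \<le> op_norm A * norm x"
  for A :: "real^'n^'m"
  unfolding op_norm_def by (rule onorm) (simp add: linear_conv_bounded_linear[symmetric])

lemma op_norm_nonneg: "0 \<le> op_norm A"
  for A :: "real^'n^'m"
  unfolding op_norm_def by (rule onorm_pos_le) (simp add: linear_conv_bounded_linear[symmetric])

lemma inner_transpose_mult: "(transpose X *v y) \<bullet> x = y \<bullet> (X *v x)"
  for X :: "real^'n^'m"
  by (simp add: dot_lmul_matrix)

text \<open>By Cauchy-Schwarz \<open>N\<close> bounds the squared operator norm of
  \<open>transpose X\<close>, hence that of its adjoint \<open>X\<close>, hence the norm of their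
  product. One inequality is enough, since exchanging \<open>X\<close> and
  \<open>transpose X\<close> gives the other.\<close>

lemma op_norm_gram_le:
  fixes X :: "real^'n^'m"
  shows "op_norm (transpose X ** X) \<le> op_norm (X ** transpose X)"
proof -
  define N where "N = op_norm (X ** transpose X)"
  have N: "N \<ge> 0" unfolding N_def by (rule op_norm_nonneg)
  have T: "norm (transpose X *v w) \<le> sqrt N * norm w" for w
  proof -
    have "(norm (transpose X *v w))\<^sup>2 = w \<bullet> ((X ** transpose X) *v w)"
      by (simp only: power2_norm_eq_inner inner_transpose_mult matrix_vector_mul_assoc)
    also have "\<dots> \<le> norm w * norm ((X ** transpose X) *v w)" by (rule norm_cauchy_schwarz)
    also have "\<dots> \<le> norm w * (N * norm w)"
      unfolding N_def by (intro mult_left_mono op_norm_bound) auto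
    also have "\<dots> = (sqrt N * norm w)\<^sup>2" using N by (simp add: power2_eq_square)
    finally show ?thesis by (rule power2_le_imp_le) (use N in auto)
  qed
  have X: "norm (X *v w) \<le> sqrt N * norm w" for w
  proof (cases "norm (X *v w) = 0")
    case False
    have "norm (X *v w) * norm (X *v w) = (transpose X *v (X *v w)) \<bullet> w"
      by (simp only: inner_transpose_mult power2_norm_eq_inner flip: power2_eq_square)
    also have "\<dots> \<le> norm (transpose X *v (X *v w)) * norm w" by (rule norm_cauchy_schwarz)
    also have "\<dots> \<le> (sqrt N * norm (X *v w)) * norm w" by (intro mult_right_mono T) auto
    finally have "norm (X *v w) * norm (X *v w) \<le> norm (X *v w) * (sqrt N * norm w)"
      by (simp add: algebra_simps)
    then show ?thesis using False by (simp add: mult_le_cancel_left)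
  qed (use N in simp)
  have "norm ((transpose X ** X) *v w) \<le> N * norm w" for w
  proof -
    have "norm (transpose X *v (X *v w)) \<le> sqrt N * (sqrt N * norm w)"
      using T[of "X *v w"] mult_left_mono[OF X, of "sqrt N" w] N by (simp add: order_trans)
    also have "\<dots> = N * norm w" using N by (simp flip: mult.assoc)
    finally show ?thesis by (simp only: matrix_vector_mul_assoc)
  qed
  then show ?thesis unfolding op_norm_def[of "transpose X ** X"] N_def by (rule onorm_le)
qed

text \<open>Of the three quantities in the bound, the two traces agree by cyclicity and the norms by
  \<open>op_norm_gram_le\<close> in both directions.\<close>

lemma quantile_bound_gram:
  fixes X :: "real^'n^'n"
  shows "quantile_bound (X ** transpose X) x = quantile_bound (transpose X ** X) x"
proof -
  have "op_norm (X ** transpose X) = op_norm (transpose X ** X)"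
    using op_norm_gram_le[of X] op_norm_gram_le[of "transpose X"] by (simp del: transpose_matrix_vector)
  moreover have "trace (X ** transpose X) = trace (transpose X ** X)" by (rule trace_mul_sym)
  moreover have "trace ((X ** transpose X) ** (X ** transpose X))
      = trace ((transpose X ** X) ** (transpose X ** X))"
    using trace_mul_sym[of X "transpose X ** (X ** transpose X)"] by (simp add: matrix_mul_assoc)
  ultimately show ?thesis by (simp add: quantile_bound_def)
qed

text \<open>Supplies the strictly positive radius needed later; \<open>trace (B ** B)\<close> is a
  sum of squared entries by symmetry.\<close>

lemma quantile_bound_pos:
  fixes B :: "real^'n^'n"
  assumes B: "positive_definite B" and x: "x > 0"
  shows "quantile_bound B x > 0"
proof -
  have sym: "B $ i $ j = B $ j $ i" for i j
    using B unfolding positive_definite_def transpose_def vec_eq_iff by (metis vec_lambda_beta)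
  have "B $ i $ i > 0" for i
  proof -
    have "0 < axis i 1 \<bullet> (B *v axis i 1)"
      using B unfolding positive_definite_def by (simp add: axis_eq_0_iff)
    then show ?thesis by (simp add: inner_axis' matrix_vector_mul_component inner_axis)
  qed
  then have "trace B > 0" unfolding trace_def by (intro sum_pos) auto
  moreover have "trace (B ** B) \<ge> 0"
    unfolding trace_def matrix_matrix_mult_def by (auto intro!: sum_nonneg simp: sym)
  ultimately show ?thesis
    unfolding quantile_bound_def using x op_norm_nonneg[of B]
    by (simp add: add_pos_nonneg)
qed

lemma norm_matrix_sqrt_power2:
  fixes A :: "real^'n^'n"
  assumes "positive_semidefinite A"
  shows "(norm (matrix_sqrt A *v u))\<^sup>2 = u \<bullet> (A *v u)"
proof -
  note S = matrix_sqrt[OF assms]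
  have "(norm (matrix_sqrt A *v u))\<^sup>2 = u \<bullet> (matrix_sqrt A *v (matrix_sqrt A *v u))"
    using symmetric_inner_swap S(1) unfolding power2_norm_eq_inner positive_semidefinite_def
    by metis
  then show ?thesis by (simp add: matrix_vector_mul_assoc S(2))
qed

text \<open>The deviation condition is applied to \<open>X\<^sup>T X = V F\<^sup>-\<^sup>1 V\<close> with \<open>X = F\<^sup>-\<^sup>1\<^sup>/\<^sup>2 V\<close>. It has the same
  quantile bound as \<open>X X\<^sup>T = F\<^sup>-\<^sup>1\<^sup>/\<^sup>2 V\<^sup>2 F\<^sup>-\<^sup>1\<^sup>/\<^sup>2\<close>, and \<open>(X\<^sup>T X)\<^sup>1\<^sup>/\<^sup>2 V\<^sup>-\<^sup>1 g\<close> has the norm of \<open>F\<^sup>-\<^sup>1\<^sup>/\<^sup>2 g\<close>.\<close>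

lemma deviation_condition_standardized:
  fixes g :: "'a \<Rightarrow> real^'n"
  assumes dev: "deviation_condition M g V2" and F: "positive_definite F" and x: "x > 0"
  defines "T \<equiv> matrix_inv (matrix_sqrt F)"
  defines "q \<equiv> quantile_bound (T ** V2 ** T) x"
  shows "q > 0"
    and "measure M {\<omega> \<in> space M. q \<le> norm (T *v g \<omega>)} \<le> 3 * exp (- x)"
proof -
  define W where "W = matrix_sqrt V2"
  define X where "X = T ** W"
  have V2: "positive_definite V2" using dev by (simp add: deviation_condition_def)
  note W = matrix_sqrt_positive_definite[OF V2, folded W_def]
  note S = matrix_sqrt_positive_definite[OF F, folded T_def]
  have XX: "X ** transpose X = T ** V2 ** T"
    unfolding X_def matrix_transpose_mul S(4) W(1) W(2)[symmetric] by (simp add: matrix_mul_assoc)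
  \<comment> \<open>Injectivity makes the Gram matrix definite, as the deviation condition
    demands.\<close>
  have inj: "X *v y \<noteq> 0" if "y \<noteq> 0" for y
  proof
    assume "X *v y = 0"
    then have "matrix_sqrt F *v (T *v (W *v y)) = 0"
      by (simp add: X_def matrix_vector_mul_assoc[symmetric])
    then have "W *v y = 0"
      using matrix_inv_right[OF S(3)]
      by (metis T_def matrix_vector_mul_assoc matrix_vector_mul_lid)
    then have "matrix_inv W *v (W *v y) = 0" by simp
    then show False
      using matrix_inv_left[OF W(3)] that by (simp add: matrix_vector_mul_assoc)
  qed
  have "positive_definite (transpose X ** X)"
    unfolding positive_definite_def
  proof (intro conjI allI impI)
    show "transpose (transpose X ** X) = transpose X ** X"
      by (simp add: matrix_transpose_mul)
    fix y :: "real^'n" assume "y \<noteq> 0"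
    have "y \<bullet> ((transpose X ** X) *v y) = (X *v y) \<bullet> (X *v y)"
      by (metis inner_commute inner_transpose_mult matrix_vector_mul_assoc)
    then show "0 < y \<bullet> ((transpose X ** X) *v y)" using inj[OF \<open>y \<noteq> 0\<close>] by simp
  qed
  note pd = this
  have q: "q = quantile_bound (transpose X ** X) x"
    unfolding q_def XX[symmetric] by (rule quantile_bound_gram)
  show "q > 0" unfolding q using pd x by (rule quantile_bound_pos)
  \<comment> \<open>Both squared norms are the form of the Gram matrix at
    \<open>matrix_inv W *v y\<close>, because X W^-1 = T.\<close>
  have eq: "norm (matrix_sqrt (transpose X ** X) *v (matrix_inv W *v y)) = norm (T *v y)" for y
  proof -
    have "(norm (matrix_sqrt (transpose X ** X) *v (matrix_inv W *v y)))\<^sup>2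
        = (norm (X *v (matrix_inv W *v y)))\<^sup>2"
      unfolding norm_matrix_sqrt_power2[OF positive_definite_imp_semidefinite[OF pd]]
      by (metis inner_commute inner_transpose_mult matrix_vector_mul_assoc power2_norm_eq_inner)
    also have "X *v (matrix_inv W *v y) = T *v y"
      using matrix_inv_right[OF W(3)]
      by (simp add: X_def matrix_vector_mul_assoc matrix_mul_assoc[symmetric])
    finally show ?thesis by simp
  qed
  have "measure M {\<omega> \<in> space M. quantile_bound (transpose X ** X) x
      \<le> norm (matrix_sqrt (transpose X ** X) *v (matrix_inv (matrix_sqrt V2) *v g \<omega>))}
          \<le> 3 * exp (- x)"
    using dev pd x unfolding deviation_condition_def by blast
  then show "measure M {\<omega> \<in> space M. q \<le> norm (T *v g \<omega>)} \<le> 3 * exp (- x)"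
    by (simp only: q eq flip: W_def)
qed

text \<open>The deviation bound concerns the event with non-strict inequality, so its complement,
  where the norm is strictly below \<open>q\<close>, lies in the desired event.\<close>

lemma (in prob_space) prob_norm_le_ge:
  fixes g :: "'a \<Rightarrow> real^'n"
  assumes [measurable]: "g \<in> borel_measurable M"
    and dev: "prob {\<omega> \<in> space M. q \<le> norm (T *v g \<omega>)} \<le> p"
  shows "1 - p \<le> prob {\<omega> \<in> space M. norm (T *v g \<omega>) \<le> q}"
proof -
  have [measurable]: "(\<lambda>y. T *v y) \<in> borel_measurable borel"
    by (intro borel_measurable_continuous_onI linear_continuous_on)
      (simp add: linear_conv_bounded_linear[symmetric])
  have "1 - p \<le> 1 - prob {\<omega> \<in> space M. q \<le> norm (T *v g \<omega>)}" using dev by simp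
  also have "\<dots> = prob {\<omega> \<in> space M. \<not> q \<le> norm (T *v g \<omega>)}"
    by (rule prob_neg[symmetric]) measurable
  also have "\<dots> \<le> prob {\<omega> \<in> space M. norm (T *v g \<omega>) \<le> q}"
    by (intro finite_measure_mono) auto
  finally show ?thesis .
qed

subsection \<open>Minimizers of a linearly perturbed convex function\<close>

text \<open>\<open>grad\<close> is a definite description, so existence and uniqueness are both
  needed: the coordinates \<open>f' b\<close> represent the derivative as an inner product, and
  derivatives are unique.\<close>

lemma GDERIV_grad:
  fixes f :: "real^'n \<Rightarrow> real"
  assumes "f differentiable (at y)"
  shows "GDERIV f y :> grad f y"
proof -
  obtain f' where f': "(f has_derivative f') (at y)" using assms by (auto simp: differentiable_def)
  have lin: "linear f'" using f' by (rule has_derivative_linear)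
  define v where "v = (\<Sum>b\<in>Basis. f' b *\<^sub>R b)"
  have "f' h = h \<bullet> v" for h
  proof -
    have "f' h = f' (\<Sum>b\<in>Basis. (h \<bullet> b) *\<^sub>R b)" by (simp add: euclidean_representation)
    also have "\<dots> = h \<bullet> v"
      by (simp add: linear_sum[OF lin] linear_cmul[OF lin] v_def inner_sum_right mult.commute)
    finally show ?thesis .
  qed
  then have "f' = (\<lambda>h. h \<bullet> v)" by auto
  with f' have v: "GDERIV f y :> v" by (simp add: gderiv_def)
  have "w = v" if "GDERIV f y :> w" for w
  proof -
    have "(\<lambda>h. h \<bullet> w) = (\<lambda>h. h \<bullet> v)"
      using that v unfolding gderiv_def by (rule has_derivative_unique)
    then show ?thesis by (metis vector_eq_ldot)
  qed
  with v show ?thesis unfolding grad_def by (rule theI)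
qed

text \<open>Along the ray \<open>h\<close> becomes a convex function of one variable with positive
  slope at 1, and its graph lies above the tangent there.\<close>

lemma convex_on_ray_less:
  fixes h :: "'a::real_normed_vector \<Rightarrow> real"
  assumes h: "convex_on Y h" and v: "v \<in> Y" "v + t *\<^sub>R u \<in> Y" and t: "t > 1"
    and deriv: "(h has_derivative h') (at (v + u))" and pos: "h' u > 0"
  shows "h (v + u) < h (v + t *\<^sub>R u)"
proof -
  define \<phi> where "\<phi> s = h (v + s *\<^sub>R u)" for s
  have conv: "convex Y" using h by (simp add: convex_on_def)
  have mem: "v + s *\<^sub>R u \<in> Y" if "s \<in> {0..t}" for s
  proof -
    have "(1 - s / t) *\<^sub>R v + (s / t) *\<^sub>R (v + t *\<^sub>R u) \<in> Y"
      using conv v that t by (intro convexD) auto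
    also have "(1 - s / t) *\<^sub>R v + (s / t) *\<^sub>R (v + t *\<^sub>R u) = v + s *\<^sub>R u"
      using t by (simp add: algebra_simps)
    finally show ?thesis .
  qed
  have "convex_on {0..t} \<phi>"
  proof (rule convex_onI)
    fix l p q :: real assume l: "0 < l" "l < 1" and pq: "p \<in> {0..t}" "q \<in> {0..t}"
    have "\<phi> ((1 - l) *\<^sub>R p + l *\<^sub>R q) = h ((1 - l) *\<^sub>R (v + p *\<^sub>R u) + l *\<^sub>R (v + q *\<^sub>R u))"
      unfolding \<phi>_def by (simp add: algebra_simps)
    also have "\<dots> \<le> (1 - l) * \<phi> p + l * \<phi> q"
      unfolding \<phi>_def using l by (intro convex_onD[OF h] mem pq) auto
    finally show "\<phi> ((1 - l) *\<^sub>R p + l *\<^sub>R q) \<le> (1 - l) * \<phi> p + l * \<phi> q" .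
  qed simp
  moreover have "(\<phi> has_field_derivative h' u) (at 1 within {0..t})"
  proof -
    have "((\<lambda>s. v + s *\<^sub>R u) has_derivative (\<lambda>s. s *\<^sub>R u)) (at 1)"
      by (auto intro!: derivative_eq_intros)
    moreover have "(h has_derivative h') (at (v + 1 *\<^sub>R u))" using deriv by simp
    ultimately have "(\<phi> has_derivative (\<lambda>s. h' (s *\<^sub>R u))) (at 1)"
      unfolding \<phi>_def by (rule has_derivative_compose)
    also have "(\<lambda>s. h' (s *\<^sub>R u)) = (*) (h' u)"
      using linear_cmul[OF has_derivative_linear[OF deriv]] by (auto simp: mult.commute)
    finally show ?thesis
      unfolding has_field_derivative_def by (rule has_derivative_at_withinI)
  qed
  ultimately have "\<phi> t - \<phi> 1 \<ge> h' u * (t - 1)"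
    using t by (intro convex_on_imp_above_tangent) auto
  moreover have "h' u * (t - 1) > 0" using pos t by simp
  ultimately show ?thesis by (simp add: \<phi>_def)
qed

text \<open>With \<open>e = v - d\<close>, one has \<open>v\<^sup>3 - 3/2 d\<^sup>3 = - d/2 (d - 3e)\<^sup>2 + (15/2 d + e) e\<^sup>2\<close> and
  \<open>15/2 d + e = 13/2 d + v \<le> 12 N\<close>.\<close>

lemma cubic_remainder_le_square:
  fixes d v w N \<kappa> \<tau> :: real
  assumes d: "0 \<le> d" "d \<le> N" and v: "0 \<le> v" "v \<le> 4 / 3 * N" "v \<le> d + \<kappa> * w"
    and \<tau>: "0 \<le> \<tau>" "\<tau> * \<kappa>\<^sup>2 * N \<le> 1 / 4"
  shows "\<tau> / 3 * v ^ 3 - \<tau> / 2 * d ^ 3 \<le> w\<^sup>2"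
proof (cases "v \<le> d")
  case True
  then have "v ^ 3 \<le> d ^ 3" using v by (intro power_mono)
  moreover have "0 \<le> d ^ 3" using d by simp
  ultimately have "1 / 3 * v ^ 3 - 1 / 2 * d ^ 3 \<le> 0" by linarith
  then have "\<tau> * (1 / 3 * v ^ 3 - 1 / 2 * d ^ 3) \<le> 0" using \<tau>(1) by (simp add: mult_nonneg_nonpos)
  also have "\<tau> * (1 / 3 * v ^ 3 - 1 / 2 * d ^ 3) = \<tau> / 3 * v ^ 3 - \<tau> / 2 * d ^ 3"
    by (simp add: right_diff_distrib)
  finally show ?thesis by (rule order_trans) simp
next
  case False
  define e where "e = v - d"
  have e: "0 \<le> e" "e \<le> \<kappa> * w" using False v by (auto simp: e_def)
  have "v ^ 3 - 3 / 2 * d ^ 3 = (15 / 2 * d + e) * e\<^sup>2 - d / 2 * (d - 3 * e)\<^sup>2"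
    unfolding e_def by (simp add: power2_eq_square power3_eq_cube algebra_simps)
  also have "\<dots> \<le> (15 / 2 * d + e) * e\<^sup>2" using d by simp
  also have "\<dots> \<le> 12 * N * e\<^sup>2" using d v(2) by (intro mult_right_mono) (auto simp: e_def)
  finally have "\<tau> / 3 * (v ^ 3 - 3 / 2 * d ^ 3) \<le> \<tau> / 3 * (12 * N * e\<^sup>2)"
    using \<tau>(1) by (intro mult_left_mono) auto
  also have "\<dots> = 4 * \<tau> * N * e\<^sup>2" by simp
  also have "\<dots> \<le> 4 * \<tau> * N * (\<kappa> * w)\<^sup>2"
    using e d \<tau> by (intro mult_left_mono power_mono) auto
  also have "\<dots> = (4 * (\<tau> * \<kappa>\<^sup>2 * N)) * w\<^sup>2" by (simp add: power_mult_distrib)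
  also have "\<dots> \<le> 1 * w\<^sup>2" using \<tau>(2) by (intro mult_right_mono) auto
  finally show ?thesis by (simp add: algebra_simps)
qed

text \<open>The metric condition \<open>D\<^sup>2 \<le> \<kappa>\<^sup>2 F\<close> enters as \<open>norm (D *v u) \<le> \<kappa> * norm (S *v u)\<close>, where
  \<open>S = F\<^sup>1\<^sup>/\<^sup>2\<close>; the perturbation is \<open>g = S *v a\<close>.\<close>

locale perturbed_convex_minimization =
  fixes f :: "real^'n \<Rightarrow> real" and \<Upsilon> :: "(real^'n) set" and v :: "real^'n"
    and S T D :: "real^'n^'n" and a :: "real^'n" and \<rho> r \<tau> \<kappa> :: real
  assumes T3: "condition_T3 f \<Upsilon> v D r \<tau>"
    and stationary: "grad f v = 0"
    and convex_f: "convex_on \<Upsilon> f"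
    and sym: "transpose S = S"
    and inv: "S ** T = mat 1"
    and hess: "\<And>u. u \<bullet> (hessian f v *v u) = (norm (S *v u))\<^sup>2"
    and D_le: "\<And>u. norm (D *v u) \<le> \<kappa> * norm (S *v u)"
    and D_nz: "\<And>u. u \<noteq> 0 \<Longrightarrow> D *v u \<noteq> 0"
    and pos: "\<kappa> > 0" "\<rho> > 0"
    and a: "norm a \<le> \<rho>"
    and r: "r \<ge> 4 * \<kappa> / 3 * \<rho>"
    and small: "\<tau> * \<kappa> ^ 3 * \<rho> < 1 / 4"
begin

definition h :: "real^'n \<Rightarrow> real" where "h y = f y + (S *v a) \<bullet> y"

text \<open>On this ellipsoid \<open>D_le\<close> and \<open>r\<close> give
  \<open>norm (D *v u) \<le> r\<close>; stationarity removes the gradient term at \<open>v\<close>,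
  and \<open>hess\<close> turns the Hessian form into a square.\<close>

lemma T3_within:
  assumes "norm (S *v u) \<le> 4 / 3 * \<rho>"
  shows "norm (D *v u) \<le> 4 * \<kappa> / 3 * \<rho>" "v + u \<in> \<Upsilon>" "f differentiable (at (v + u))"
    "\<bar>f (v + u) - f v - 1 / 2 * (norm (S *v u))\<^sup>2\<bar> \<le> \<tau> / 6 * norm (D *v u) ^ 3"
    "\<bar>grad f (v + u) \<bullet> u - (norm (S *v u))\<^sup>2\<bar> \<le> \<tau> / 2 * norm (D *v u) ^ 3"
proof -
  have "norm (D *v u) \<le> \<kappa> * norm (S *v u)" by (rule D_le)
  also have "\<dots> \<le> \<kappa> * (4 / 3 * \<rho>)" using assms pos by (intro mult_left_mono) auto
  finally show *: "norm (D *v u) \<le> 4 * \<kappa> / 3 * \<rho>" by simp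
  with r have "norm (D *v u) \<le> r" by simp
  with T3 show "v + u \<in> \<Upsilon>" "f differentiable (at (v + u))"
    "\<bar>f (v + u) - f v - 1 / 2 * (norm (S *v u))\<^sup>2\<bar> \<le> \<tau> / 6 * norm (D *v u) ^ 3"
    "\<bar>grad f (v + u) \<bullet> u - (norm (S *v u))\<^sup>2\<bar> \<le> \<tau> / 2 * norm (D *v u) ^ 3"
    unfolding condition_T3_def stationary hess by auto
qed

lemma S_T: "S *v (T *v y) = y"
  by (simp add: matrix_vector_mul_assoc inv)

lemma T_S: "T *v (S *v y) = y"
  using inv matrix_left_right_inverse[of S T] by (simp add: matrix_vector_mul_assoc)

lemma inner_g: "(S *v a) \<bullet> u = a \<bullet> (S *v u)"
  using symmetric_inner_swap[OF sym] by simp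

text \<open>A bound on an absolute value cannot be negative; it suffices to test one
  \<open>u\<close> with \<open>D *v u \<noteq> 0\<close> inside the ellipsoid.\<close>

lemma tau_nonneg: "\<tau> \<ge> 0"
proof -
  define u where "u = T *v (\<rho> *\<^sub>R axis undefined 1)"
  have Su: "S *v u = \<rho> *\<^sub>R axis undefined 1" by (simp add: u_def S_T)
  then have "u \<noteq> 0" using pos by (auto simp: axis_eq_0_iff)
  then have "norm (D *v u) ^ 3 > 0" using D_nz by simp
  moreover have "norm (S *v u) \<le> 4 / 3 * \<rho>" using pos by (simp add: Su)
  then have "0 \<le> \<tau> / 6 * norm (D *v u) ^ 3" using T3_within(4) abs_ge_zero order_trans by blast
  ultimately show ?thesis by (simp add: zero_le_mult_iff)
qed

lemma convex_h: "convex_on \<Upsilon> h"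
proof -
  have "convex_on \<Upsilon> (\<lambda>y. (S *v a) \<bullet> y)"
    using convex_f by (auto simp: convex_on_def inner_add_right)
  then show ?thesis unfolding h_def[abs_def] by (intro convex_on_add convex_f)
qed

lemma has_derivative_h:
  assumes "f differentiable (at y)"
  shows "(h has_derivative (\<lambda>u. u \<bullet> (grad f y + S *v a))) (at y)"
  using GDERIV_grad[OF assms] unfolding gderiv_def h_def[abs_def]
  by (auto intro!: derivative_eq_intros simp: inner_add_right inner_commute)

text \<open>At distance \<open>s = 4/3 \<rho>\<close> the radial derivative of \<open>h\<close> is at least
  \<open>s (s - \<rho> - \<tau> \<kappa>\<^sup>3 s\<^sup>2 / 2) > s \<rho> (1/3 - 2/9)\<close>.\<close>

lemma radial_derivative_pos:
  assumes u: "norm (S *v u) = 4 / 3 * \<rho>"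
  shows "u \<bullet> (grad f (v + u) + S *v a) > 0"
proof -
  define s where "s = norm (S *v u)"
  have s: "s = 4 / 3 * \<rho>" using u by (simp add: s_def)
  have "\<tau> / 2 * norm (D *v u) ^ 3 \<le> \<tau> / 2 * (\<kappa> * s) ^ 3"
    unfolding s_def using tau_nonneg D_le by (intro mult_left_mono power_mono) auto
  also have "\<dots> = (\<tau> * \<kappa> ^ 3 * \<rho>) * (32 / 27 * \<rho>\<^sup>2)"
    unfolding s by (simp add: power_mult_distrib power2_eq_square power3_eq_cube)
  also have "\<dots> \<le> 1 / 4 * (32 / 27 * \<rho>\<^sup>2)"
    using small by (intro mult_right_mono) auto
  finally have "\<tau> / 2 * norm (D *v u) ^ 3 \<le> 8 / 27 * \<rho>\<^sup>2" by simp
  moreover have "u \<bullet> grad f (v + u) \<ge> s\<^sup>2 - \<tau> / 2 * norm (D *v u) ^ 3"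
    using T3_within(5)[OF eq_refl[OF u]] unfolding s_def inner_commute[of u] by linarith
  moreover have "u \<bullet> (S *v a) \<ge> - (\<rho> * s)"
  proof -
    have "\<bar>a \<bullet> (S *v u)\<bar> \<le> norm a * s" unfolding s_def by (rule Cauchy_Schwarz_ineq2)
    also have "\<dots> \<le> \<rho> * s" using a by (intro mult_right_mono) (auto simp: s_def)
    finally show ?thesis using inner_g[of u] by (simp add: inner_commute)
  qed
  \<comment> \<open>The coefficients of \<rho>^2 balance as 16/9 - 8/27 - 4/3 = 4/27 > 0.\<close>
  moreover have "s\<^sup>2 = 16 / 9 * \<rho>\<^sup>2" "\<rho> * s = 4 / 3 * \<rho>\<^sup>2" "\<rho>\<^sup>2 > 0"
    unfolding s using pos by (auto simp: power2_eq_square)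
  ultimately show ?thesis unfolding inner_add_right by linarith
qed

text \<open>The segment from \<open>v\<close> to \<open>y\<close> crosses the ellipsoid at
  \<open>v + u\<close>, where \<open>h\<close> is already increasing outwards. This serves both to
  localize minimizers and to find one.\<close>

lemma outside_not_minimal:
  assumes y: "y \<in> \<Upsilon>" and out: "norm (S *v (y - v)) > 4 / 3 * \<rho>"
  obtains u where "norm (S *v u) \<le> 4 / 3 * \<rho>" "h (v + u) < h y"
proof -
  define t where "t = norm (S *v (y - v)) / (4 / 3 * \<rho>)"
  have t: "t > 1" using out pos unfolding t_def by simp
  define u where "u = (1 / t) *\<^sub>R (y - v)"
  have u: "norm (S *v u) = 4 / 3 * \<rho>"
    unfolding u_def linear_cmul[OF matrix_vector_mul_linear] norm_scaleR
    using pos t by (auto simp: t_def)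
  have y_eq: "y = v + t *\<^sub>R u" using t by (simp add: u_def)
  have "v \<in> \<Upsilon>" using T3_within(2)[of 0] pos by simp
  then have "h (v + u) < h y"
    unfolding y_eq
    by (rule convex_on_ray_less[OF convex_h _ _ t has_derivative_h radial_derivative_pos[OF u]])
      (use y y_eq T3_within(3)[of u] u in auto)
  with eq_refl[OF u] show ?thesis by (rule that)
qed

lemma minimizer_within:
  assumes "is_arg_min h (\<lambda>y. y \<in> \<Upsilon>) y"
  shows "norm (S *v (y - v)) \<le> 4 / 3 * \<rho>"
proof (rule ccontr)
  assume "\<not> ?thesis"
  then obtain u where "norm (S *v u) \<le> 4 / 3 * \<rho>" "h (v + u) < h y"
    using outside_not_minimal[of y] assms by (auto simp: is_arg_min_def)
  then show False using assms T3_within(2) by (auto simp: is_arg_min_def)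
qed

text \<open>\<open>h\<close> attains its minimum over the compact ellipsoid \<open>K\<close>, and
  every point of \<Upsilon> outside \<open>K\<close> is beaten by one inside.\<close>

lemma ex_minimizer: "\<exists>y. is_arg_min h (\<lambda>y. y \<in> \<Upsilon>) y"
proof -
  define K where "K = (\<lambda>w. v + T *v w) ` cball 0 (4 / 3 * \<rho>)"
  have K: "y \<in> K \<longleftrightarrow> norm (S *v (y - v)) \<le> 4 / 3 * \<rho>" for y
  proof
    assume "norm (S *v (y - v)) \<le> 4 / 3 * \<rho>"
    then show "y \<in> K" unfolding K_def by (intro image_eqI[of _ _ "S *v (y - v)"]) (auto simp: T_S)
  qed (auto simp: K_def S_T)
  have "compact K"
    unfolding K_def
    by (intro compact_continuous_image continuous_intros linear_continuous_on)
      (auto simp flip: linear_conv_bounded_linear)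
  moreover have "continuous_on K h"
  proof (rule continuous_at_imp_continuous_on, rule ballI)
    fix y assume "y \<in> K"
    then have "f differentiable (at (v + (y - v)))" using K by (intro T3_within) auto
    then show "isCont h y" using has_derivative_h has_derivative_continuous by fastforce
  qed
  moreover have "v \<in> K" using K pos by simp
  ultimately obtain y where y: "y \<in> K" and min: "\<And>z. z \<in> K \<Longrightarrow> h y \<le> h z"
    using continuous_attains_inf[of K h] by blast
  have "y \<in> \<Upsilon>" using T3_within(2)[of "y - v"] y K by simp
  moreover have "h y \<le> h z" if z: "z \<in> \<Upsilon>" for z
  proof (cases "z \<in> K")
    case False
    then obtain u where "norm (S *v u) \<le> 4 / 3 * \<rho>" "h (v + u) < h z"
      using outside_not_minimal[OF z] K by (metis not_le)
    then show ?thesis using min[of "v + u"] K by simp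
  qed (rule min)
  ultimately show ?thesis by (auto simp: is_arg_min_linorder)
qed

text \<open>Complete the square: |S u|^2 + 2 <a, S u> = |S u + a|^2 - |a|^2. Doubling turns \<tau>/6
  into \<tau>/3.\<close>

lemma h_expansion:
  assumes "norm (S *v u) \<le> 4 / 3 * \<rho>"
  shows "\<bar>2 * h (v + u) - 2 * h v + (norm a)\<^sup>2 - (norm (S *v u + a))\<^sup>2\<bar>
    \<le> \<tau> / 3 * norm (D *v u) ^ 3"
proof -
  have "2 * h (v + u) - 2 * h v + (norm a)\<^sup>2 - (norm (S *v u + a))\<^sup>2
      = 2 * (f (v + u) - f v - 1 / 2 * (norm (S *v u))\<^sup>2)"
    unfolding h_def inner_add_right inner_g[of u] power2_norm_eq_inner
    by (simp add: inner_add_left inner_add_right inner_commute algebra_simps)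
  then show ?thesis using T3_within(4)[OF assms] by (simp only: abs_mult) simp
qed

lemma minimum_value:
  assumes y: "is_arg_min h (\<lambda>y. y \<in> \<Upsilon>) y"
  shows "\<bar>2 * h y - 2 * h v + (norm a)\<^sup>2\<bar> \<le> \<tau> / 2 * norm (D *v (T *v a)) ^ 3"
proof -
  define d where "d = norm (D *v (T *v a))"
  define u where "u = y - v"
  have d: "0 \<le> d" "d \<le> \<kappa> * norm a" unfolding d_def using D_le[of "T *v a"] by (auto simp: S_T)
  have Su: "norm (S *v u) \<le> 4 / 3 * \<rho>" unfolding u_def using y by (rule minimizer_within)
  \<comment> \<open>At \<open>- (T *v a)\<close> the completed square is zero, so only the cubic
    remainder is left.\<close>
  have "norm (S *v (- (T *v a))) \<le> 4 / 3 * \<rho>"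
    using a pos by (simp add: S_T linear_neg[OF matrix_vector_mul_linear])
  from h_expansion[OF this] T3_within(2)[OF this]
  have "\<bar>2 * h (v - T *v a) - 2 * h v + (norm a)\<^sup>2\<bar> \<le> \<tau> / 3 * d ^ 3" "v - T *v a \<in> \<Upsilon>"
    by (auto simp: S_T linear_neg[OF matrix_vector_mul_linear] d_def)
  moreover have "h y \<le> h (v - T *v a)"
    using y \<open>v - T *v a \<in> \<Upsilon>\<close> by (simp add: is_arg_min_linorder)
  moreover have "\<tau> / 3 * d ^ 3 \<le> \<tau> / 2 * d ^ 3"
    using tau_nonneg d by (intro mult_right_mono) auto
  ultimately have upper: "2 * h y - 2 * h v + (norm a)\<^sup>2 \<le> \<tau> / 2 * d ^ 3" by linarith
  \<comment> \<open>D u and -D T a differ by D T (S u + a), so their distance is controlled by the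
    completed square.\<close>
  have "D *v u = D *v (T *v (S *v u + a)) - D *v (T *v a)"
    by (simp add: T_S matrix_vector_right_distrib)
  then have "norm (D *v u) \<le> norm (D *v (T *v (S *v u + a))) + d"
    unfolding d_def by (metis norm_triangle_ineq4)
  also have "\<dots> \<le> \<kappa> * norm (S *v u + a) + d"
    using D_le[of "T *v (S *v u + a)"] by (simp add: S_T)
  finally have Du: "norm (D *v u) \<le> d + \<kappa> * norm (S *v u + a)" by simp
  \<comment> \<open>Here \<open>N\<close> is \<kappa>\<rho> and \<open>w\<close> is the root of the
    completed square, so \<open>small\<close> provides the condition with 1/4.\<close>
  have "\<tau> / 3 * norm (D *v u) ^ 3 - \<tau> / 2 * d ^ 3 \<le> (norm (S *v u + a))\<^sup>2"
  proof (rule cubic_remainder_le_square[of _ "\<kappa> * \<rho>", OF d(1) _ _ _ Du tau_nonneg])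
    show "d \<le> \<kappa> * \<rho>" using d(2) mult_left_mono[OF a, of \<kappa>] pos by linarith
    show "norm (D *v u) \<le> 4 / 3 * (\<kappa> * \<rho>)" using T3_within(1)[OF Su] by simp
    show "\<tau> * \<kappa>\<^sup>2 * (\<kappa> * \<rho>) \<le> 1 / 4"
      using small by (simp add: power2_eq_square power3_eq_cube mult.assoc)
  qed simp
  then have "- (\<tau> / 2 * d ^ 3) \<le> 2 * h y - 2 * h v + (norm a)\<^sup>2"
    using h_expansion[OF Su] unfolding u_def add_diff_cancel_left' diff_add_cancel
      add.commute[of v "y - v"] by linarith
  with upper show ?thesis unfolding d_def[symmetric] by linarith
qed

end

section \<open>Passage from the random criterion to the perturbed deterministic problem\<close>

theorem theorem2p3:
  fixes M :: "'a measure"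
    and L :: "'a \<Rightarrow> real^'n \<Rightarrow> real"
    and \<Upsilon> :: "(real^'n) set"
    and f :: "real^'n \<Rightarrow> real"
    and \<upsilon>s :: "real^'n"
    and d\<zeta> :: "'a \<Rightarrow> real^'n"
    and F V2 B D :: "real^'n^'n"
    and x r\<^sub>B r \<tau>\<^sub>3 \<kappa> :: real
    and \<Omega> :: "'a set"
  assumes "prob_space M"
    and "\<And>\<upsilon>. \<upsilon> \<in> \<Upsilon> \<Longrightarrow> integrable M (\<lambda>\<omega>. L \<omega> \<upsilon>)"
    and f: "f = (\<lambda>\<upsilon>. \<integral>\<omega>. L \<omega> \<upsilon> \<partial>M)"
    and "is_arg_min f (\<lambda>\<upsilon>. \<upsilon> \<in> \<Upsilon>) \<upsilon>s"
    and F: "F = hessian f \<upsilon>s"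
    and "positive_definite F"
    and "stochastically_linear M L \<Upsilon> d\<zeta>"
    and "deviation_condition M d\<zeta> V2"
    and "open \<Upsilon>" and "convex \<Upsilon>" and "convex_on \<Upsilon> f"
    and "x > 0"
    and B: "B = matrix_inv (matrix_sqrt F) ** V2 ** matrix_inv (matrix_sqrt F)"
    and r\<^sub>B: "r\<^sub>B = quantile_bound B x"
    and "positive_definite D"
    and "condition_T3 f \<Upsilon> \<upsilon>s D r \<tau>\<^sub>3"
    and "\<kappa> > 0"
    and "D ** D \<preceq>\<^sub>L \<kappa>\<^sup>2 *\<^sub>R F"
    and "r \<ge> 4 * \<kappa> / 3 * r\<^sub>B"
    and "\<tau>\<^sub>3 * \<kappa> ^ 3 * r\<^sub>B < 1 / 4"
    and \<Omega>: "\<Omega> = {\<omega> \<in> space M. norm (matrix_inv (matrix_sqrt F) *v d\<zeta> \<omega>) \<le> r\<^sub>B}"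
  shows "measure M \<Omega> \<ge> 1 - 3 * exp (- x) \<and>
    (\<forall>\<omega>\<in>\<Omega>.
       (\<exists>\<upsilon>t. is_arg_min (L \<omega>) (\<lambda>\<upsilon>. \<upsilon> \<in> \<Upsilon>) \<upsilon>t) \<and>
       (\<forall>\<upsilon>t. is_arg_min (L \<omega>) (\<lambda>\<upsilon>. \<upsilon> \<in> \<Upsilon>) \<upsilon>t \<longrightarrow>
          norm (matrix_sqrt F *v (\<upsilon>t - \<upsilon>s)) \<le> 4 / 3 * r\<^sub>B \<and>
          norm (D *v (\<upsilon>t - \<upsilon>s)) \<le> 4 * \<kappa> / 3 * r\<^sub>B \<and>
          \<bar>2 * L \<omega> \<upsilon>t - 2 * L \<omega> \<upsilon>s + (norm (matrix_inv (matrix_sqrt F) *v d\<zeta> \<omega>))\<^sup>2\<bar>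
            \<le> \<tau>\<^sub>3 / 2 * norm (D *v (matrix_inv F *v d\<zeta> \<omega>)) ^ 3))"
proof -
  interpret prob_space M by fact
  define S where "S = matrix_sqrt F"
  define T where "T = matrix_inv S"
  note S = matrix_sqrt_positive_definite[OF \<open>positive_definite F\<close>, folded S_def, folded T_def]
  note ST = matrix_inv_right[OF S(3), folded T_def]
  note dev = deviation_condition_standardized[OF \<open>deviation_condition M d\<zeta> V2\<close>
      \<open>positive_definite F\<close> \<open>x > 0\<close>, folded B, folded r\<^sub>B]
  have g: "d\<zeta> \<in> borel_measurable M"
    using \<open>stochastically_linear M L \<Upsilon> d\<zeta>\<close> by (simp add: stochastically_linear_def)
  have "\<upsilon>s \<in> \<Upsilon>" and min: "\<forall>y\<in>\<Upsilon>. f \<upsilon>s \<le> f y"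
    using \<open>is_arg_min f (\<lambda>\<upsilon>. \<upsilon> \<in> \<Upsilon>) \<upsilon>s\<close> by (auto simp: is_arg_min_linorder)
  \<comment> \<open>A nonnegative radius admits \<open>u = 0\<close> in the smoothness condition,
    which yields differentiability at the minimizer.\<close>
  have "r \<ge> 0" using assms(19) dev(1) \<open>\<kappa> > 0\<close> by (smt (verit) divide_nonneg_nonneg mult_nonneg_nonneg)
  then have "f differentiable (at \<upsilon>s)"
    using \<open>condition_T3 f \<Upsilon> \<upsilon>s D r \<tau>\<^sub>3\<close> unfolding condition_T3_def
    by (metis add.right_neutral matrix_vector_mult_0_right norm_zero)
  then have "(f has_derivative (\<lambda>u. u \<bullet> grad f \<upsilon>s)) (at \<upsilon>s)"
    using GDERIV_grad by (simp add: gderiv_def)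
  \<comment> \<open>\<Upsilon> is open, so the minimizer is interior and Fermat's rule
    applies.\<close>
  then have "(\<lambda>u. u \<bullet> grad f \<upsilon>s) = (\<lambda>_. 0)"
    using differential_zero_maxmin[OF \<open>\<upsilon>s \<in> \<Upsilon>\<close> \<open>open \<Upsilon>\<close>] min by blast
  then have grad: "grad f \<upsilon>s = 0" by (metis inner_eq_zero_iff)
  have hess: "u \<bullet> (hessian f \<upsilon>s *v u) = (norm (S *v u))\<^sup>2" for u
    using norm_matrix_sqrt_power2[OF positive_definite_imp_semidefinite[OF \<open>positive_definite F\<close>]]
    by (simp add: S_def F)
  have D_le: "norm (D *v u) \<le> \<kappa> * norm (S *v u)" for u
  proof (rule power2_le_imp_le)
    have "transpose D = D" using \<open>positive_definite D\<close> by (simp add: positive_definite_def)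
    then have "(norm (D *v u))\<^sup>2 = u \<bullet> ((D ** D) *v u)"
      by (metis power2_norm_eq_inner symmetric_inner_swap matrix_vector_mul_assoc)
    also have "\<dots> \<le> u \<bullet> ((\<kappa>\<^sup>2 *\<^sub>R F) *v u)"
      using \<open>D ** D \<preceq>\<^sub>L \<kappa>\<^sup>2 *\<^sub>R F\<close>
      by (simp add: loewner_le_def positive_semidefinite_def matrix_vector_mult_diff_rdistrib
          inner_diff_right)
    also have "\<dots> = (\<kappa> * norm (S *v u))\<^sup>2"
      using hess[of u] by (simp add: F power_mult_distrib flip: scaleR_matrix_vector_assoc)
    finally show "(norm (D *v u))\<^sup>2 \<le> (\<kappa> * norm (S *v u))\<^sup>2" .
  qed (use \<open>\<kappa> > 0\<close> in simp)
  have D_nz: "D *v u \<noteq> 0" if "u \<noteq> 0" for u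
    using \<open>positive_definite D\<close> that unfolding positive_definite_def
    by (metis inner_zero_right less_irrefl)
  have "1 - 3 * exp (- x) \<le> measure M \<Omega>"
    unfolding \<Omega> by (rule prob_norm_le_ge[OF g dev(2)])
  moreover have "(\<exists>\<upsilon>t. is_arg_min (L \<omega>) (\<lambda>\<upsilon>. \<upsilon> \<in> \<Upsilon>) \<upsilon>t) \<and>
    (\<forall>\<upsilon>t. is_arg_min (L \<omega>) (\<lambda>\<upsilon>. \<upsilon> \<in> \<Upsilon>) \<upsilon>t \<longrightarrow>
      norm (S *v (\<upsilon>t - \<upsilon>s)) \<le> 4 / 3 * r\<^sub>B \<and> norm (D *v (\<upsilon>t - \<upsilon>s)) \<le> 4 * \<kappa> / 3 * r\<^sub>B \<and>
      \<bar>2 * L \<omega> \<upsilon>t - 2 * L \<omega> \<upsilon>s + (norm (T *v d\<zeta> \<omega>))\<^sup>2\<bar>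
        \<le> \<tau>\<^sub>3 / 2 * norm (D *v (matrix_inv F *v d\<zeta> \<omega>)) ^ 3)" if "\<omega> \<in> \<Omega>" for \<omega>
  proof -
    have \<omega>: "\<omega> \<in> space M" "norm (T *v d\<zeta> \<omega>) \<le> r\<^sub>B"
      using that by (auto simp: \<Omega> S_def T_def)
    \<comment> \<open>The deterministic result is instantiated for each outcome separately;
      membership in \<Omega> is the bound on \<open>a\<close>.\<close>
    interpret perturbed_convex_minimization f \<Upsilon> \<upsilon>s S T D "T *v d\<zeta> \<omega>" r\<^sub>B r \<tau>\<^sub>3 \<kappa>
      by unfold_locales (fact assms grad S(1) ST hess D_le D_nz dev(1) \<omega>(2) | erule D_nz)+
    \<comment> \<open>The random offset \<open>c\<close> does not depend on the point, so it affects
      neither minimizers nor differences of values.\<close>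
    obtain c where "\<And>y. y \<in> \<Upsilon> \<Longrightarrow> L \<omega> y - f y = c + d\<zeta> \<omega> \<bullet> y"
      using \<open>stochastically_linear M L \<Upsilon> d\<zeta>\<close> \<omega>(1) unfolding stochastically_linear_def f by blast
    then have L: "L \<omega> y = h y + c" if "y \<in> \<Upsilon>" for y
      unfolding h_def S_T using that by (simp add: algebra_simps)
    have arg_min: "is_arg_min (L \<omega>) (\<lambda>\<upsilon>. \<upsilon> \<in> \<Upsilon>) y \<longleftrightarrow> is_arg_min h (\<lambda>\<upsilon>. \<upsilon> \<in> \<Upsilon>) y" for y
      using L by (auto simp: is_arg_min_linorder)
    have FT: "matrix_inv F *v d\<zeta> \<omega> = T *v (T *v d\<zeta> \<omega>)"
      by (simp add: S(5) matrix_vector_mul_assoc)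
    have "\<bar>2 * L \<omega> y - 2 * L \<omega> \<upsilon>s + (norm (T *v d\<zeta> \<omega>))\<^sup>2\<bar>
        \<le> \<tau>\<^sub>3 / 2 * norm (D *v (matrix_inv F *v d\<zeta> \<omega>)) ^ 3"
      if "is_arg_min h (\<lambda>\<upsilon>. \<upsilon> \<in> \<Upsilon>) y" for y
      using minimum_value[OF that] that L \<open>\<upsilon>s \<in> \<Upsilon>\<close> by (simp add: FT is_arg_min_def)
    then show ?thesis
      unfolding arg_min using ex_minimizer minimizer_within T3_within(1) by blast
  qed
  ultimately show ?thesis unfolding S_def T_def by blast
qed

end
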